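(* In the group \(\mathcal{G}\) described below, for each \(i\) the element \(s_i=t_it_{i+7}\) is an involution, and \(s_i=s_{i+7}\) for \(i=1,\dots,7\).
   Context: Let \(\mathcal{G}=\langle x,y,t \mid x^7, y^2, (xy)^3, [x,y]^4, t^2, [t^{x^2},yx^{-1}], [t,y], (yt^{x^2})^5, (xyx^2t^x)^5, (xt)^8\rangle\), with \(a^g=g^{-1}ag\), \([a,b]=a^{-1}b^{-1}ab\). Let \(\mathcal{N}=\langle x,y\rangle\le\mathcal{G}\); it acts on \(\{1,\dots,14\}\) on the right via \(x\mapsto(1,2,3,4,5,6,7)(8,9,10,11,12,13,14)\), \(y\mapsto(1,12)(2,3)(4,11)(5,8)(6,13)(9,10)\). Put \(t_7=t\) and \(t_i=t^g\) for any \(g\in\mathcal{N}\) mapping \(7\) to \(i\) (well defined since the stabilizer of 7 centralizes \(t\)); indices are taken modulo 14 (so \(t_{15}=t_1\), etc.), and \(s_i=t_it_{i+7}\) for \(1\le i\le 14\). *)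

theory Defs
  imports "HOL-Algebra.Group"
begin

definition gconj :: "('a, 'b) monoid_scheme \<Rightarrow> 'a \<Rightarrow> 'a \<Rightarrow> 'a" where
  "gconj H a g = inv\<^bsub>H\<^esub> g \<otimes>\<^bsub>H\<^esub> a \<otimes>\<^bsub>H\<^esub> g"

definition gcomm :: "('a, 'b) monoid_scheme \<Rightarrow> 'a \<Rightarrow> 'a \<Rightarrow> 'a" where
  "gcomm H a b = inv\<^bsub>H\<^esub> a \<otimes>\<^bsub>H\<^esub> inv\<^bsub>H\<^esub> b \<otimes>\<^bsub>H\<^esub> a \<otimes>\<^bsub>H\<^esub> b"

definition G_relations :: "('a, 'b) monoid_scheme \<Rightarrow> 'a \<Rightarrow> 'a \<Rightarrow> 'a \<Rightarrow> bool" where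
  "G_relations H x y t \<longleftrightarrow>
     x [^]\<^bsub>H\<^esub> (7::nat) = \<one>\<^bsub>H\<^esub> \<and>
     y [^]\<^bsub>H\<^esub> (2::nat) = \<one>\<^bsub>H\<^esub> \<and>
     (x \<otimes>\<^bsub>H\<^esub> y) [^]\<^bsub>H\<^esub> (3::nat) = \<one>\<^bsub>H\<^esub> \<and>
     (gcomm H x y) [^]\<^bsub>H\<^esub> (4::nat) = \<one>\<^bsub>H\<^esub> \<and>
     t [^]\<^bsub>H\<^esub> (2::nat) = \<one>\<^bsub>H\<^esub> \<and>
     gcomm H (gconj H t (x [^]\<^bsub>H\<^esub> (2::nat))) (y \<otimes>\<^bsub>H\<^esub> inv\<^bsub>H\<^esub> x) = \<one>\<^bsub>H\<^esub> \<and>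
     gcomm H t y = \<one>\<^bsub>H\<^esub> \<and>
     (y \<otimes>\<^bsub>H\<^esub> gconj H t (x [^]\<^bsub>H\<^esub> (2::nat))) [^]\<^bsub>H\<^esub> (5::nat) = \<one>\<^bsub>H\<^esub> \<and>
     (x \<otimes>\<^bsub>H\<^esub> y \<otimes>\<^bsub>H\<^esub> x [^]\<^bsub>H\<^esub> (2::nat) \<otimes>\<^bsub>H\<^esub> gconj H t x) [^]\<^bsub>H\<^esub> (5::nat) = \<one>\<^bsub>H\<^esub> \<and>
     (x \<otimes>\<^bsub>H\<^esub> t) [^]\<^bsub>H\<^esub> (8::nat) = \<one>\<^bsub>H\<^esub>"

text \<open>Words in the generators x, y of N (inverses are positive powers since x^7 = y^2 = 1).\<close>
datatype gen = GX | GY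

definition gen_val :: "('a, 'b) monoid_scheme \<Rightarrow> 'a \<Rightarrow> 'a \<Rightarrow> gen \<Rightarrow> 'a" where
  "gen_val H x y g = (case g of GX \<Rightarrow> x | GY \<Rightarrow> y)"

definition word_eval :: "('a, 'b) monoid_scheme \<Rightarrow> 'a \<Rightarrow> 'a \<Rightarrow> gen list \<Rightarrow> 'a" where
  "word_eval H x y w = foldr (\<lambda>g acc. gen_val H x y g \<otimes>\<^bsub>H\<^esub> acc) w \<one>\<^bsub>H\<^esub>"

text \<open>Permutation images on {1..14}:
  x = (1,2,3,4,5,6,7)(8,9,10,11,12,13,14),
  y = (1,12)(2,3)(4,11)(5,8)(6,13)(9,10).\<close>
definition perm_x :: "nat \<Rightarrow> nat" where
  "perm_x p = (if p \<in> {1..6} \<or> p \<in> {8..13} then p + 1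
               else if p = 7 then 1 else if p = 14 then 8 else p)"

definition perm_y :: "nat \<Rightarrow> nat" where
  "perm_y p = (if p = 1 then 12 else if p = 12 then 1
          else if p = 2 then 3 else if p = 3 then 2
          else if p = 4 then 11 else if p = 11 then 4
          else if p = 5 then 8 else if p = 8 then 5
          else if p = 6 then 13 else if p = 13 then 6
          else if p = 9 then 10 else if p = 10 then 9 else p)"

definition gen_perm :: "gen \<Rightarrow> nat \<Rightarrow> nat" where
  "gen_perm g = (case g of GX \<Rightarrow> perm_x | GY \<Rightarrow> perm_y)"

text \<open>Right action: the point p^(g1...gn) is obtained by applying g1 first.\<close>
definition word_perm :: "gen list \<Rightarrow> nat \<Rightarrow> nat" where
  "word_perm w p = fold gen_perm w p"

text \<open>Indices modulo 14, represented in {1..14}.\<close>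
definition idx14 :: "nat \<Rightarrow> nat" where
  "idx14 k = ((k + 13) mod 14) + 1"

end

theory Submission
  imports Defs
begin

text \<open>
  Choose words r_1, ..., r_14 in x, y with 7^(r_j) = j and r_7 = 1. A certificate shows that
  for each generator g, r_j g = s r_(j^g) where s is a word in y and c = x^2 (y x^-1) x^-2;
  both y and c commute with t by the relations [t, y] = 1 and [t^(x^2), y x^-1] = 1. By
  induction on words, every u \<in> N is s r_(7^u) with s centralising t, so t^u = t^(r_(7^u))
  depends only on 7^u and t_i is well defined.

  A second certificate reduces t_7 t_14 t_7 to t_14 using t_i^2 = 1, the relations (x t)^8,
  (y t^(x^2))^5 and (x y x^2 t^x)^5, and u t_j = t_k u for u \<in> N with k^u = j. Hence t_7 and
  t_14 commute, and conjugating by r_i, which maps 7 to i and 14 to i + 7, so do t_i and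
  t_(i+7). Thus s_i is a product of two commuting involutions, and s_i = t_(i+7) t_i = s_(i+7).
\<close>

section \<open>Rewriting certificates\<close>

type_synonym 'c rule = "'c list \<times> 'c list"

text \<open>A step \<open>(k, p, True)\<close> replaces the left side of rule \<open>k\<close> occurring at position \<open>p\<close>
  by its right side; \<open>(k, p, False)\<close> applies rule \<open>k\<close> from right to left.\<close>
type_synonym rewrite_step = "nat \<times> nat \<times> bool"

definition rewrite_at :: "'c rule list \<Rightarrow> rewrite_step \<Rightarrow> 'c list \<Rightarrow> 'c list option" where
  "rewrite_at R s w = (case s of (k, p, fwd) \<Rightarrow>
     if k < length R \<and> p \<le> length w then
       (let a = (if fwd then fst (R ! k) else snd (R ! k));
            b = (if fwd then snd (R ! k) else fst (R ! k))
        in if take (length a) (drop p w) = a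
           then Some (take p w @ b @ drop (p + length a) w) else None)
     else None)"

fun rewrite_chain :: "'c rule list \<Rightarrow> rewrite_step list \<Rightarrow> 'c list \<Rightarrow> 'c list option" where
  "rewrite_chain R [] w = Some w"
| "rewrite_chain R (s # ss) w = Option.bind (rewrite_at R s w) (rewrite_chain R ss)"

type_synonym 'c derivation = "'c list \<times> 'c list \<times> rewrite_step list"

fun valid_derivations :: "'c rule list \<Rightarrow> 'c derivation list \<Rightarrow> bool" where
  "valid_derivations R [] \<longleftrightarrow> True"
| "valid_derivations R ((l, r, c) # ds) \<longleftrightarrow>
     rewrite_chain R c l = Some r \<and> valid_derivations (R @ [(l, r)]) ds"

definition derived_rules :: "'c derivation list \<Rightarrow> 'c rule list" where
  "derived_rules ds = map (\<lambda>(l, r, c). (l, r)) ds"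

locale list_eval = group G for G :: "('a, 'b) monoid_scheme" (structure) +
  fixes ev :: "'c list \<Rightarrow> 'a"
  assumes ev_closed [simp]: "ev w \<in> carrier G"
    and ev_Nil [simp]: "ev [] = \<one>"
    and ev_append [simp]: "ev (u @ v) = ev u \<otimes> ev v"
begin

definition rules_hold :: "'c rule list \<Rightarrow> bool" where
  "rules_hold R \<longleftrightarrow> (\<forall>(l, r) \<in> set R. ev l = ev r)"

lemma ev_Cons: "ev (a # w) = ev [a] \<otimes> ev w"
  using ev_append[of "[a]" w] by simp

lemma ev_replace_drop:
  assumes "ev (drop p w) = ev v"
  shows "ev w = ev (take p w @ v)"
  by (metis append_take_drop_id assms ev_append)

lemma rewrite_at_sound:
  assumes "rules_hold R" and "rewrite_at R s w = Some w'"
  shows "ev w = ev w'"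
proof -
  obtain k p fwd where s: "s = (k, p, fwd)" by (cases s)
  define a b where "a = (if fwd then fst (R ! k) else snd (R ! k))"
    and "b = (if fwd then snd (R ! k) else fst (R ! k))"
  from assms(2) have k: "k < length R" and match: "take (length a) (drop p w) = a"
    and w': "w' = take p w @ b @ drop (p + length a) w"
    by (auto simp: rewrite_at_def s a_def b_def Let_def split: if_splits)
  have "ev a = ev b"
    using assms(1) nth_mem[OF k] by (cases "R ! k") (auto simp: rules_hold_def a_def b_def)
  moreover have "drop p w = a @ drop (p + length a) w"
    using match by (metis append_take_drop_id drop_drop add.commute)
  ultimately show ?thesis
    using w' ev_replace_drop[of p w "b @ drop (p + length a) w"] by simp
qed

lemma rewrite_chain_sound:
  "rules_hold R \<Longrightarrow> rewrite_chain R ss w = Some w' \<Longrightarrow> ev w = ev w'"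
proof (induction ss arbitrary: w)
  case (Cons s ss)
  then obtain w1 where "rewrite_at R s w = Some w1" and "rewrite_chain R ss w1 = Some w'"
    by (auto split: Option.bind_splits)
  with Cons show ?case by (metis rewrite_at_sound)
qed simp

lemma valid_derivations_sound:
  "rules_hold R \<Longrightarrow> valid_derivations R ds \<Longrightarrow> rules_hold (R @ derived_rules ds)"
proof (induction ds arbitrary: R)
  case (Cons d ds)
  obtain l r c where d: "d = (l, r, c)" by (cases d)
  with Cons.prems have "rules_hold (R @ [(l, r)])"
    using rewrite_chain_sound[of R c l r] by (auto simp: rules_hold_def)
  with Cons.IH[of "R @ [(l, r)]"] Cons.prems show ?case
    by (simp add: d derived_rules_def)
qed (simp add: derived_rules_def)

lemma ev_concat_replicate: "ev (concat (replicate n w)) = ev w [^] n"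
proof (induction n)
  case (Suc n)
  then show ?case using nat_pow_Suc2[of "ev w" n] by simp
qed simp

lemma ev_rotate: "ev w = \<one> \<Longrightarrow> ev (rotate n w) = \<one>"
proof (induction n)
  case (Suc n)
  then have rot: "ev (rotate n w) = \<one>" by blast
  show ?case
  proof (cases "rotate n w")
    case (Cons a v)
    then have "ev [a] \<otimes> ev v = \<one>" using rot ev_Cons[of a v] by simp
    then have "ev v \<otimes> ev [a] = \<one>" by (rule inv_comm) simp_all
    with Cons show ?thesis by simp
  qed (simp add: rot)
qed simp

lemma ev_concat_rev_map:
  assumes "\<And>a. ev (f a) = inv (ev [a])"
  shows "ev (concat (rev (map f w))) = inv (ev w)"
proof (induction w)
  case (Cons a w)
  then show ?case using ev_Cons[of a w] by (simp add: assms inv_mult_group)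
qed simp

end

lemma (in group) list_eval_foldr:
  assumes "\<And>a. f a \<in> carrier G"
  shows "list_eval G (\<lambda>w. foldr (\<lambda>a acc. f a \<otimes> acc) w \<one>)"
proof -
  have closed: "foldr (\<lambda>a acc. f a \<otimes> acc) w \<one> \<in> carrier G" for w
    by (induction w) (simp_all add: assms)
  show ?thesis
  proof
    show "foldr (\<lambda>a acc. f a \<otimes> acc) (u @ v) \<one>
        = foldr (\<lambda>a acc. f a \<otimes> acc) u \<one> \<otimes> foldr (\<lambda>a acc. f a \<otimes> acc) v \<one>" for u v
      by (induction u) (simp_all add: assms closed m_assoc)
  qed (simp_all add: closed)
qed

lemma (in group) mult_inv_cancel [simp]:
  "a \<in> carrier G \<Longrightarrow> b \<in> carrier G \<Longrightarrow> a \<otimes> (inv a \<otimes> b) = b"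
  by (simp add: m_assoc[symmetric])

definition (in group) centraliser :: "'a \<Rightarrow> 'a set" where
  "centraliser a = {g \<in> carrier G. g \<otimes> a = a \<otimes> g}"

lemma (in group) subgroup_centraliser:
  assumes "a \<in> carrier G"
  shows "subgroup (centraliser a) G"
proof
  show "g \<otimes> h \<in> centraliser a" if "g \<in> centraliser a" "h \<in> centraliser a" for g h
  proof -
    from that have g: "g \<in> carrier G" "g \<otimes> a = a \<otimes> g"
      and h: "h \<in> carrier G" "h \<otimes> a = a \<otimes> h" by (auto simp: centraliser_def)
    have "g \<otimes> h \<otimes> a = g \<otimes> a \<otimes> h" using g(1) h assms by (simp add: m_assoc)
    also have "\<dots> = a \<otimes> (g \<otimes> h)" using g h(1) assms by (simp add: m_assoc)
    finally show ?thesis using g h by (simp add: centraliser_def)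
  qed
next
  show "inv g \<in> centraliser a" if "g \<in> centraliser a" for g
  proof -
    from that have g: "g \<in> carrier G" and ga: "g \<otimes> a = a \<otimes> g" by (auto simp: centraliser_def)
    have "inv g \<otimes> a = inv g \<otimes> (a \<otimes> g) \<otimes> inv g"
      using g assms by (simp add: m_assoc)
    also have "\<dots> = a \<otimes> inv g" using g assms ga[symmetric] by (simp add: m_assoc[symmetric])
    finally show ?thesis using g by (simp add: centraliser_def)
  qed
qed (auto simp: centraliser_def assms)

lemma (in group) commute_if_gcomm_one:
  assumes "a \<in> carrier G" "b \<in> carrier G" "gcomm G a b = \<one>"
  shows "a \<otimes> b = b \<otimes> a"
  using assms unfolding gcomm_def
  by (metis inv_closed inv_equality inv_inv inv_mult_group m_assoc m_closed)

lemma (in group) gconj_closed [simp]: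
  "a \<in> carrier G \<Longrightarrow> g \<in> carrier G \<Longrightarrow> gconj G a g \<in> carrier G"
  by (simp add: gconj_def)

lemma (in group) gconj_mult:
  assumes "a \<in> carrier G" "g \<in> carrier G" "h \<in> carrier G"
  shows "gconj G a (g \<otimes> h) = gconj G (gconj G a g) h"
  using assms by (simp add: gconj_def inv_mult_group m_assoc)

lemma (in group) gconj_centraliser:
  "g \<in> centraliser a \<Longrightarrow> a \<in> carrier G \<Longrightarrow> gconj G a g = a"
  by (auto simp: centraliser_def gconj_def m_assoc inv_solve_left')

lemma (in group) gconj_involution:
  "a \<in> carrier G \<Longrightarrow> g \<in> carrier G \<Longrightarrow> a \<otimes> a = \<one> \<Longrightarrow> gconj G a g \<otimes> gconj G a g = \<one>"
  by (simp add: gconj_def m_assoc) (simp add: m_assoc[symmetric])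

lemma (in group) commuting_involutions_product:
  assumes "a \<in> carrier G" "b \<in> carrier G" "a \<otimes> a = \<one>" "b \<otimes> b = \<one>" "a \<otimes> b = b \<otimes> a"
  shows "(a \<otimes> b) [^] (2::nat) = \<one>"
proof -
  have "(a \<otimes> b) [^] (2::nat) = a \<otimes> (b \<otimes> a) \<otimes> b"
    using assms(1,2) by (simp add: numeral_2_eq_2 m_assoc)
  also have "\<dots> = a \<otimes> (a \<otimes> b) \<otimes> b" using assms(5) by simp
  also have "\<dots> = (a \<otimes> a) \<otimes> (b \<otimes> b)" using assms(1,2) by (simp add: m_assoc)
  finally show ?thesis using assms(3,4) by simp
qed

lemma (in group) centraliser_of_gconj:
  assumes a: "a \<in> carrier G" and g: "g \<in> carrier G"
    and b: "b \<in> centraliser (gconj G a g)"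
  shows "g \<otimes> b \<otimes> inv g \<in> centraliser a"
proof -
  have bc: "b \<in> carrier G" and comm: "b \<otimes> gconj G a g = gconj G a g \<otimes> b"
    using b by (auto simp: centraliser_def)
  have "g \<otimes> b \<otimes> inv g \<otimes> a = g \<otimes> (b \<otimes> gconj G a g) \<otimes> inv g"
    using a g bc by (simp add: gconj_def m_assoc)
  also have "\<dots> = g \<otimes> (gconj G a g \<otimes> b) \<otimes> inv g" by (simp only: comm)
  also have "\<dots> = a \<otimes> (g \<otimes> b \<otimes> inv g)"
    using a g bc by (simp add: gconj_def m_assoc[symmetric])
  finally show ?thesis using g bc by (simp add: centraliser_def)
qed

lemma (in group) gconj_commute:
  assumes "a \<in> carrier G" "b \<in> carrier G" "g \<in> carrier G" "a \<otimes> b = b \<otimes> a"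
  shows "gconj G a g \<otimes> gconj G b g = gconj G b g \<otimes> gconj G a g"
proof -
  have "gconj G a g \<otimes> gconj G b g = inv g \<otimes> (a \<otimes> b) \<otimes> g"
    using assms(1-3) by (simp add: gconj_def m_assoc)
  also have "\<dots> = inv g \<otimes> (b \<otimes> a) \<otimes> g" using assms(4) by simp
  also have "\<dots> = gconj G b g \<otimes> gconj G a g"
    using assms(1-3) by (simp add: gconj_def m_assoc)
  finally show ?thesis .
qed

lemma list_eval_word_eval:
  assumes "group H" "x \<in> carrier H" "y \<in> carrier H"
  shows "list_eval H (word_eval H x y)"
proof -
  interpret group H by fact
  have "gen_val H x y g \<in> carrier H" for g
    using assms by (cases g) (simp_all add: gen_val_def)
  then show ?thesis
    unfolding word_eval_def by (rule list_eval_foldr)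
qed

fun gen_inv_word :: "gen \<Rightarrow> gen list" where
  "gen_inv_word GX = replicate 6 GX"
| "gen_inv_word GY = [GY]"

definition inv_word :: "gen list \<Rightarrow> gen list" where
  "inv_word w = concat (rev (map gen_inv_word w))"

text \<open>The last relator [x, y]^4 is written with x^-1 = x^6 and y^-1 = y.\<close>
definition N_relators :: "gen rule list" where
  "N_relators = [(replicate 7 GX, []), ([GY, GY], []), ([GX, GY, GX, GY, GX, GY], []),
     (concat (replicate 4 (replicate 6 GX @ [GY, GX, GY])), [])]"

definition N_derivations :: "gen derivation list" where
  "N_derivations = [([GX,GX,GX,GX,GX,GX,GX],[],[(0,0,True)]),
  ([GY,GY],[],[(1,0,True)]),
  ([GX,GY,GX,GY,GX,GY],[],[(2,0,True)]),
  ([GX,GX,GX,GX,GX,GX,GY,GX,GY,GX,GX,GX,GX,GX,GX,GY,GX,GY,GX,GX,GX,GX,GX,GX,GY,GX,GY,GX,GX,GX,GX,GX,GX,GY,GX,GY],[],[(3,0,True)]),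
  ([GX,GY,GX,GY,GX],[GY],[(5,5,False),(6,0,True)]),
  ([GX,GX,GX,GX,GX,GY,GX,GX,GX,GX,GY,GX,GX,GX,GX,GY,GX,GX,GX,GX,GX,GY,GX,GY],[],[(8,15,False),(8,10,False),(8,5,False),(7,0,True)]),
  ([GY,GX,GX,GX,GX,GX,GX],[GX,GY,GX,GY],[(8,0,False),(4,4,True)]),
  ([GX,GX,GX,GX,GX,GX],[GY,GX,GY,GX,GY],[(5,0,False),(10,1,True)]),
  ([GY,GX,GY,GX,GX,GY,GX],[GX,GX,GX,GX,GX,GY],[(5,4,False),(11,0,False),(8,5,True)]),
  ([GY,GX,GX,GX,GX,GX,GY],[GX,GY,GX,GX,GY,GX],[(12,1,False),(5,0,True)]),
  ([GY,GX,GY,GX,GX,GX,GY,GX,GX,GX,GY,GX,GX,GX,GY,GX,GX,GY],[],[(5,4,False),(11,0,False),(13,5,False),(13,10,False),(13,15,False),(9,0,True)]),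
  ([GX,GY,GX,GX,GY,GX,GY],[GY,GX,GX,GX,GX,GX],[(13,0,False),(5,6,True)]),
  ([GX,GY,GX,GX,GY,GX,GX,GY,GX],[GY,GX,GX,GX,GX,GY],[(13,0,False),(8,5,True)]),
  ([GX,GX,GX,GX,GX,GY,GX,GX,GX,GX,GX],[GY,GX,GY,GX,GX,GX,GY,GX,GY],[(12,0,False),(11,6,True),(5,5,True)]),
  ([GY,GX,GX,GX,GX,GY,GX,GX,GX,GX,GX],[GX,GY,GX,GX,GY,GX,GX,GX,GY,GX,GY],[(15,5,False),(13,0,True)]),
  ([GY,GX,GY,GX,GX,GX,GY,GX,GX,GY,GX],[GX,GX,GX,GX,GX,GY,GX,GX,GX,GX,GY],[(13,5,False),(12,0,True)]),
  ([GX,GY,GX,GX,GY,GX,GX,GX,GY,GX,GX,GY,GX],[GY,GX,GX,GX,GX,GY,GX,GX,GX,GX,GY],[(5,10,False),(18,0,False),(8,10,True)]),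
  ([GX,GX,GX,GX,GX,GY,GX,GX,GX,GX,GY,GX,GX,GX,GX,GY],[GY,GX,GY,GX,GX,GX,GY,GX,GX,GX,GY,GX,GX,GY,GX],[(19,0,False),(13,9,True)]),
  ([GX,GY,GX,GX,GY,GX,GX,GX,GY,GX,GX,GX,GY,GX,GX,GY,GX],[GY,GX,GX,GX,GX,GY,GX,GX,GX,GX,GY,GX,GX,GX,GX,GY],[(13,11,False),(20,0,True)]),
  ([GY,GX,GY,GX,GX,GX,GY,GX,GX,GX,GY,GX,GX,GX,GY,GX,GX],[GY],[(5,17,False),(14,0,True)]),
  ([GX,GY,GX,GX,GX,GY,GX,GX,GX,GY,GX,GX,GX,GY,GX,GX],[],[(5,0,False),(23,1,True),(5,0,True)]),
  ([GX,GY,GX,GX,GX,GY,GX,GX,GX,GY,GX,GX,GX,GY,GX,GY],[GY,GX,GY,GX],[(8,15,False),(24,0,True)]),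
  ([GX,GY,GX,GX,GX,GY,GX,GX,GX,GY,GX,GX,GX,GY,GX],[GY,GX,GY,GX,GY],[(5,15,False),(25,0,True)]),
  ([GX,GY,GX,GX,GX,GY,GX,GX,GX,GY,GX,GX,GX],[GX,GX,GX,GX,GX,GY],[(5,13,False),(8,14,False),(26,0,True),(5,4,True),(12,0,True)]),
  ([GX,GY,GX,GX,GX,GY,GX,GX,GX,GY,GX,GX,GY],[GY,GX,GY,GX,GX],[(8,12,False),(27,0,True),(5,5,True),(11,0,True),(5,4,True)]),
  ([GX,GX,GX,GX,GX,GY,GX,GX,GX,GX,GY,GX,GX,GX,GX,GY],[GX,GY,GX,GX,GX],[(21,0,True),(28,1,True),(5,0,True)]),
  ([GY,GX,GX,GX,GX,GY,GX,GX,GX,GX,GY,GX,GX,GX,GX,GY],[GX,GX,GX],[(22,0,False),(28,3,True),(8,0,True),(5,0,True)]),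
  ([GX,GY,GX,GX,GX,GY,GX,GX,GX,GY,GX,GX],[GY,GX,GY,GX,GX,GY],[(5,12,False),(28,0,True)]),
  ([GX,GY,GX,GX,GX,GY,GX,GX,GX,GY,GX,GY],[GY,GX,GY,GX,GX,GX,GY,GX],[(8,11,False),(31,0,True),(5,5,True)]),
  ([GX,GY,GX,GX,GX,GY,GX,GX,GX,GY,GX],[GY,GX,GY,GX,GX,GX,GY,GX,GY],[(5,11,False),(32,0,True)]),
  ([GX,GX,GX,GX,GX,GY,GX,GX,GX,GX,GY],[GX,GY,GX,GX,GX,GY,GX,GX,GX],[(19,0,False),(5,8,False),(33,0,False),(8,10,True),(5,9,True)]),
  ([GY,GX,GY,GX,GX,GX,GY,GX,GX,GY,GX],[GX,GY,GX,GX,GX,GY,GX,GX,GX],[(19,0,True),(34,0,True)]),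
  ([GY,GX,GY,GX,GX,GX,GY,GX,GX],[GX,GY,GX,GX,GX,GY,GX,GX,GY],[(5,8,False),(33,0,False),(8,8,True)]),
  ([GX,GY,GX,GX,GX,GY,GX,GX,GX,GY],[GX,GX,GX,GX,GX,GY,GX,GX,GX,GX],[(34,0,False),(5,10,True)]),
  ([GX,GY,GX,GX,GY,GX,GX,GX,GY,GX,GX,GY],[GX,GX,GX,GY,GX,GX],[(36,3,False),(8,0,True),(5,0,True)]),
  ([GY,GX,GX,GX,GX,GY,GX,GX,GX,GX,GY],[GX,GX,GX,GY,GX,GX,GX],[(20,0,False),(38,0,True)]),
  ([GX,GX,GY,GX,GX,GX,GY,GX,GX,GY],[GY,GX,GX,GY,GX,GX],[(36,1,False),(8,0,True)]),
  ([GX,GX,GY,GX,GX,GX,GY,GX,GX],[GY,GX,GX,GY,GX,GX,GY],[(5,9,False),(40,0,True)]),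
  ([GY,GX,GX,GX,GX,GY,GX,GX,GX,GX],[GX,GX,GX,GY,GX,GX,GX,GY],[(5,10,False),(39,0,True)]),
  ([GX,GY,GX,GX,GY,GX,GX,GX,GY,GX,GY],[GX,GX,GX,GY,GX,GX,GX,GY,GX],[(18,0,False),(42,0,True)]),
  ([GY,GX,GX,GX,GY,GX,GX,GX,GY],[GX,GX,GX,GX,GY,GX,GX,GX,GX],[(42,1,False),(5,0,True)]),
  ([GX,GX,GX,GX,GY,GX,GX,GX,GX,GY],[GY,GX,GX,GX,GY,GX,GX,GX],[(44,0,False),(5,8,True)]),
  ([GX,GY,GX,GX,GY,GX,GX,GX,GY,GX],[GX,GX,GX,GY,GX,GX,GX,GY,GX,GY],[(5,10,False),(43,0,True)]),
  ([GX,GX,GX,GX,GX,GY,GX,GX,GY,GX,GX],[GY,GX,GX,GX,GY,GX,GX,GY],[(13,4,False),(44,0,False),(8,7,True)]),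
  ([GY,GX,GX,GY,GX,GX,GX,GY,GX],[GX,GX,GY,GX,GX,GX,GY,GX,GY],[(5,6,False),(41,0,False),(8,8,True)]),
  ([GX,GX,GY,GX,GX,GY,GX,GX,GX,GX,GX],[GY,GX,GX,GY,GX,GX,GX,GY],[(13,1,False),(44,3,False),(8,0,True)]),
  ([GY,GX,GX,GY,GX,GX,GX,GX,GY,GX,GY],[GX,GX,GY,GX,GX,GY,GX,GX,GX,GX],[(5,7,False),(11,8,False),(48,0,True),(8,5,True)]),
  ([GX,GX,GY,GX,GX,GY,GX,GX,GX,GX,GY],[GY,GX,GX,GY,GX,GX,GX,GX,GY,GX],[(50,0,False),(5,10,True)]),
  ([GY,GX,GX,GY,GX,GX,GY,GX,GX,GX,GX],[GX,GX,GY,GX,GX,GX,GX,GY,GX,GY],[(50,1,False),(5,0,True)]),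
  ([GY,GX,GX,GX,GY,GX,GX,GX,GX,GY,GX],[GX,GX,GX,GX,GY,GX,GX,GX,GY],[(45,0,False),(8,8,True)]),
  ([GY,GX,GX,GX,GX,GY,GX,GX,GX,GY],[GX,GX,GX,GY,GX,GX,GX,GX,GY,GX],[(53,1,False),(5,0,True)]),
  ([GX,GX,GX,GY,GX,GX,GX,GX,GY,GX,GY],[GY,GX,GX,GX,GX,GY,GX,GX,GX],[(54,0,False),(5,9,True)]),
  ([GX,GX,GX,GY,GX,GX,GX,GX,GY,GX,GX,GY,GX],[GY,GX,GX,GX,GX,GY,GX,GX,GY],[(54,0,False),(8,8,True)]),
  ([GX,GY,GX,GX,GX,GY,GX,GX,GY,GX,GX,GX,GX],[GY,GX,GY,GX,GX,GX,GX,GY,GX,GY],[(36,0,False),(11,7,True),(5,6,True)]),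
  ([GX,GX,GX,GX,GY,GX,GX,GY,GX,GX,GY],[GY,GX,GY,GX,GX,GX,GX,GY,GX,GX],[(41,4,False),(11,0,True),(5,4,True)]),
  ([GY,GX,GY,GX,GX,GX,GX,GY,GX,GX,GY],[GX,GX,GX,GX,GY,GX,GX,GY,GX,GX],[(58,0,False),(5,10,True)]),
  ([GY,GX,GX,GX,GX,GY,GX,GX,GY,GX,GX],[GX,GY,GX,GX,GX,GX,GY,GX,GX,GY],[(59,1,False),(5,0,True)]),
  ([GY,GX,GX,GX,GY,GX,GX,GX,GX,GY],[GX,GY,GX,GX,GX,GX,GY,GX,GX,GX],[(8,0,False),(45,4,True),(5,3,True)]),
  ([GY,GX,GY,GX,GX,GX,GX,GY,GX,GX,GX],[GX,GX,GX,GY,GX,GX,GX,GX,GY],[(61,1,False),(5,0,True)]),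
  ([GX,GY,GX,GX,GY,GX,GX,GX,GX,GY,GX,GX,GX],[GY,GX,GX,GY,GX,GX,GX,GX,GY],[(61,3,False),(8,0,True)]),
  ([GX,GX,GY,GX,GX,GX,GX,GY,GX,GX,GY,GX],[GY,GX,GX,GY,GX,GX,GY,GX,GX,GX,GY],[(5,9,False),(52,0,False),(8,10,True)]),
  ([GX,GY,GX,GX,GX,GY,GX,GX,GY,GX,GX,GX,GY],[GX,GX,GX,GX,GY,GX,GX,GY,GX,GX,GX],[(36,0,False),(13,6,True),(59,0,True)]),
  ([GX,GY,GX,GX,GX,GY,GX,GX,GY,GX,GX,GX],[GX,GX,GX,GX,GY,GX,GX,GY,GX,GX,GX,GY],[(5,12,False),(65,0,True)]),
  ([GX,GY,GX,GX,GY,GX,GX,GX,GX,GY,GX,GX],[GY,GX,GX,GX,GY,GX,GX,GY,GX,GX,GY],[(13,0,False),(41,4,True)]),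
  ([GY,GX,GX,GY,GX,GX,GX,GX,GY,GX,GX,GX],[GX,GY,GX,GX,GX,GY,GX,GX,GY,GX,GX,GY],[(51,0,False),(51,2,False),(5,11,False),(66,0,False),(8,11,True)]),
  ([GY,GX,GX,GY,GX,GX,GX,GX,GY,GX,GX,GY],[GX,GX,GX,GX,GY,GX,GX,GY,GX,GX,GX,GX],[(8,11,False),(68,0,True),(5,11,True),(66,0,True),(5,11,True)]),
  ([GX,GX,GX,GY,GX,GX,GX,GX,GY,GX,GX,GX],[GY,GX,GX,GY,GX,GX,GY,GX,GX,GY],[(62,0,False),(11,8,True),(5,7,True),(13,2,True)]),
  ([GY,GX,GX,GX,GY,GX,GX,GY,GX,GX,GX,GX],[GX,GX,GX,GX,GX,GY,GX,GX,GX,GY,GX,GY],[(47,0,False),(11,9,True),(5,8,True)]),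
  ([GY,GX,GX,GX,GY,GX,GX,GY,GX,GX,GX,GY],[GX,GX,GX,GY,GX,GX,GY,GX,GX,GX],[(8,11,False),(71,0,True),(5,11,True),(41,3,True),(5,9,True)]),
  ([GY,GX,GX,GX,GY,GX,GX,GY,GX,GX,GX],[GX,GX,GX,GY,GX,GX,GY,GX,GX,GX,GY],[(5,11,False),(72,0,True)])]"

definition N_rules :: "gen rule list" where
  "N_rules = N_relators @ derived_rules N_derivations"

lemma N_derivations_valid: "valid_derivations N_relators N_derivations"
  by code_simp

text \<open>\<open>coset_rep i\<close> is r_i; it maps 7 to i and 14 to i + 7. Index 0 is unused.\<close>
definition coset_rep :: "nat \<Rightarrow> gen list" where
  "coset_rep i = [[], [GX], [GX, GX], [GX, GX, GX], [GX, GX, GX, GX], [GX, GX, GX, GX, GX],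
     [GX, GX, GX, GX, GX, GX], [], [GX, GY, GX, GX, GX], [GX, GY, GX, GX, GX, GX],
     [GX, GY, GX, GX, GX, GX, GX], [GX, GY, GX, GX, GX, GX, GX, GX], [GX, GY], [GX, GY, GX],
     [GX, GY, GX, GX]] ! i"

lemma coset_rep_points:
  "\<forall>i \<in> set [1..<15]. word_perm (coset_rep i) 7 = i \<and> word_perm (coset_rep i) 14 = idx14 (i + 7)"
  by code_simp

text \<open>The element c = x^2 y x^4 = x^2 (y x^-1) x^-2 of the stabiliser of 7.\<close>
definition stab_gen :: "gen list" where
  "stab_gen = [GX, GX, GY, GX, GX, GX, GX]"

definition stab_word :: "bool list \<Rightarrow> gen list" where
  "stab_word L = concat (map (\<lambda>b. if b then stab_gen else [GY]) L)"

text \<open>An entry ((j, g), (L, c)) says that the steps c rewrite r_j g into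
  \<open>stab_word L @ r_(j^g)\<close>.\<close>
definition schreier_data :: "((nat \<times> gen) \<times> bool list \<times> rewrite_step list) list" where
  "schreier_data = [((1,GX),([],[])),
  ((1,GY),([],[])),
  ((2,GX),([],[])),
  ((2,GY),([True],[(8,2,False),(5,2,False),(11,3,False)])),
  ((3,GX),([],[])),
  ((3,GY),([True,True],[(8,3,False),(5,3,False),(11,4,False),(5,5,False),(5,2,False),(11,3,False)])),
  ((4,GX),([],[])),
  ((4,GY),([True,True],[(8,4,False),(5,4,False),(11,5,False),(5,6,False),(5,3,False),(11,4,False),(5,5,False),(5,2,False),(11,3,False)])),
  ((5,GX),([],[(11,0,True),(11,0,False)])),
  ((5,GY),([True,False,True,True],[(12,0,False),(8,5,False),(17,0,False),(44,1,False),(8,5,False),(5,5,False),(11,6,False),(15,5,False),(60,0,False),(16,0,False),(64,1,False),(54,0,False),(48,3,False),(64,0,False)])),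
  ((6,GX),([],[(11,0,True),(8,1,True),(5,0,True)])),
  ((6,GY),([False],[(11,0,True),(5,4,True)])),
  ((7,GX),([],[])),
  ((7,GY),([False],[])),
  ((8,GX),([],[])),
  ((8,GY),([True,False,True,True],[(8,5,False),(5,5,False),(11,6,False),(8,5,False),(5,5,False),(11,6,False),(15,5,False),(60,0,False),(16,0,False),(64,1,False),(54,0,False),(48,3,False),(64,0,False)])),
  ((9,GX),([],[])),
  ((9,GY),([True,False,True],[(16,1,False),(41,2,False),(42,1,False),(5,9,False),(60,0,False),(16,0,False),(64,1,False),(54,0,False),(48,3,False),(64,0,False)])),
  ((10,GX),([],[(11,2,True),(5,1,True),(5,1,False),(11,2,False)])),
  ((10,GY),([False,True,False],[(13,1,True),(8,5,False),(48,0,False),(49,0,False),(50,0,False)])),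
  ((11,GX),([],[(11,2,True),(5,1,True),(8,1,True)])),
  ((11,GY),([True],[(11,2,True),(5,1,True),(5,4,True),(8,2,False),(5,2,False),(11,3,False)])),
  ((12,GX),([],[])),
  ((12,GY),([],[(5,1,True)])),
  ((13,GX),([],[])),
  ((13,GY),([False],[(5,0,False),(11,1,False)])),
  ((14,GX),([],[])),
  ((14,GY),([True,True,False,True],[(8,4,False),(5,4,False),(11,5,False),(15,4,False),(36,0,False),(8,6,False),(5,4,False),(11,0,False),(48,4,False),(13,3,False),(5,5,False),(5,2,False),(11,3,False)]))]"

definition schreier_ok :: "nat \<Rightarrow> gen \<Rightarrow> bool" where
  "schreier_ok j g = (case map_of schreier_data (j, g) of
       None \<Rightarrow> False
     | Some (L, c) \<Rightarrow> 1 \<le> gen_perm g j \<and> gen_perm g j \<le> 14 \<and>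
         rewrite_chain N_rules c (coset_rep j @ [g]) = Some (stab_word L @ coset_rep (gen_perm g j)))"

lemma schreier_data_ok: "\<forall>j \<in> set [1..<15]. schreier_ok j GX \<and> schreier_ok j GY"
  by code_simp

datatype item = NWord "gen list" | TPoint nat

text \<open>The relators (x t)^8, (y t^(x^2))^5 and (x y x^2 t^x)^5, with t^(x^2) = t_2 and
  t^x = t_1.\<close>
definition t_relators :: "item list list" where
  "t_relators = [concat (replicate 8 [NWord [GX], TPoint 7]),
     concat (replicate 5 [NWord [GY], TPoint 2]),
     concat (replicate 5 [NWord [GX, GY, GX, GX], TPoint 1])]"

fun inv_item :: "item \<Rightarrow> item" where
  "inv_item (NWord u) = NWord (inv_word u)"
| "inv_item (TPoint i) = TPoint i"

definition inv_items :: "item list \<Rightarrow> item list" where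
  "inv_items M = concat (rev (map (\<lambda>a. [inv_item a]) M))"

definition relator_conj :: "nat \<Rightarrow> nat \<Rightarrow> bool \<Rightarrow> gen list \<Rightarrow> item list" where
  "relator_conj k r fwd g = [NWord (inv_word g)]
     @ rotate r (if fwd then t_relators ! k else inv_items (t_relators ! k)) @ [NWord g]"

datatype item_step =
    InsertPair nat nat | DeletePair nat | InsertRelator nat nat nat bool "gen list"
  | MoveRight nat | Merge nat | RewriteN nat "rewrite_step list" | DeleteEmpty nat

text \<open>\<open>MoveRight\<close> replaces u t_j by t_k u, where k = j^(u^-1).\<close>
fun apply_item_step :: "item_step \<Rightarrow> item list \<Rightarrow> item list option" where
  "apply_item_step (InsertPair p i) M =
     (if p \<le> length M then Some (take p M @ [TPoint i, TPoint i] @ drop p M) else None)"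
| "apply_item_step (DeletePair p) M = (case drop p M of
     TPoint i # TPoint j # rest \<Rightarrow> if i = j then Some (take p M @ rest) else None
   | _ \<Rightarrow> None)"
| "apply_item_step (InsertRelator p k r fwd g) M =
     (if p \<le> length M \<and> k < 3 then Some (take p M @ relator_conj k r fwd g @ drop p M) else None)"
| "apply_item_step (MoveRight p) M = (case drop p M of
     NWord u # TPoint j # rest \<Rightarrow>
       (let k = word_perm (inv_word u) j in
        if 1 \<le> k \<and> k \<le> 14 \<and> word_perm u k = j
        then Some (take p M @ [TPoint k, NWord u] @ rest) else None)
   | _ \<Rightarrow> None)"
| "apply_item_step (Merge p) M = (case drop p M of
     NWord u # NWord v # rest \<Rightarrow> Some (take p M @ [NWord (u @ v)] @ rest)
   | _ \<Rightarrow> None)"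
| "apply_item_step (RewriteN p c) M = (case drop p M of
     NWord u # rest \<Rightarrow> map_option (\<lambda>v. take p M @ [NWord v] @ rest) (rewrite_chain N_rules c u)
   | _ \<Rightarrow> None)"
| "apply_item_step (DeleteEmpty p) M = (case drop p M of
     NWord [] # rest \<Rightarrow> Some (take p M @ rest)
   | _ \<Rightarrow> None)"

fun run_item_steps :: "item_step list \<Rightarrow> item list \<Rightarrow> item list option" where
  "run_item_steps [] M = Some M"
| "run_item_steps (s # ss) M = Option.bind (apply_item_step s M) (run_item_steps ss)"

definition t7_t14_certificate :: "item_step list" where
  "t7_t14_certificate = [InsertPair 1 6,
  InsertPair 2 7,
  InsertPair 3 6,
  InsertPair 4 7,
  InsertRelator 5 1 0 True [GX,GX,GX,GX],
  Merge 5,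
  MoveRight 5,
  Merge 6,
  MoveRight 6,
  Merge 7,
  MoveRight 7,
  Merge 8,
  MoveRight 8,
  Merge 9,
  MoveRight 9,
  Merge 10,
  MoveRight 10,
  MoveRight 11,
  MoveRight 12,
  MoveRight 13,
  MoveRight 14,
  MoveRight 15,
  RewriteN 16 [(11,0,True),(8,1,True),(5,0,True),(11,0,True),(8,1,True),(5,0,True),(11,0,True),(8,1,True),(5,0,True),(5,3,True),(5,3,True)],
  DeletePair 4,
  DeletePair 3,
  DeletePair 2,
  DeletePair 1,
  DeletePair 0,
  InsertPair 2 13,
  InsertPair 3 14,
  InsertPair 4 6,
  InsertRelator 5 2 0 True [GY,GX,GX,GX,GY,GX,GX,GY],
  Merge 5,
  MoveRight 5,
  Merge 6,
  MoveRight 6,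
  Merge 7,
  MoveRight 7,
  Merge 8,
  MoveRight 8,
  Merge 9,
  MoveRight 9,
  Merge 10,
  MoveRight 10,
  MoveRight 11,
  MoveRight 12,
  MoveRight 13,
  MoveRight 14,
  MoveRight 15,
  MoveRight 16,
  Merge 17,
  RewriteN 17 [(11,1,True),(5,0,True),(8,0,True),(13,0,True),(11,5,True),(5,4,True),(8,4,True),(11,5,True),(5,4,True),(8,4,True),(13,4,True),(16,4,True),(67,0,True),(5,10,True),(73,0,True),(48,3,True),(8,8,True),(5,8,True),(17,0,True),(5,8,True),(36,0,True),(16,4,True),(50,1,True),(49,1,True),(48,1,True),(8,6,True),(5,6,True),(70,0,True),(5,9,True),(52,0,True),(8,6,True)],
  DeletePair 4,
  DeletePair 3,
  DeletePair 2,
  DeletePair 1,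
  DeletePair 0,
  InsertPair 6 13,
  InsertPair 7 14,
  InsertRelator 8 2 0 True [GY,GX,GX,GY,GX,GX,GY,GX,GX,GX,GY],
  Merge 8,
  MoveRight 8,
  Merge 9,
  MoveRight 9,
  Merge 10,
  MoveRight 10,
  Merge 11,
  MoveRight 11,
  Merge 12,
  MoveRight 12,
  Merge 13,
  MoveRight 13,
  MoveRight 14,
  MoveRight 15,
  Merge 16,
  RewriteN 16 [(11,1,True),(5,0,True),(8,0,True),(11,1,True),(5,0,True),(8,0,True),(42,0,True),(41,1,True),(16,0,True),(42,0,True),(8,6,True),(49,1,True),(48,1,True),(8,6,True),(51,1,True),(67,0,True),(5,10,True),(73,0,True),(48,3,True),(8,8,True),(5,8,True),(17,0,True),(5,8,True),(36,0,True),(16,4,True),(67,0,True),(5,10,True),(73,0,True),(48,3,True),(5,11,True),(41,3,True),(16,2,True),(5,7,True),(11,3,True),(5,2,True),(5,5,True),(64,1,True),(16,0,True),(60,0,True),(5,9,True)],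
  DeletePair 7,
  DeletePair 6,
  DeletePair 5,
  DeletePair 4,
  DeletePair 3,
  InsertRelator 6 1 0 True [GY,GX,GX,GX,GX,GY],
  Merge 6,
  MoveRight 6,
  Merge 7,
  MoveRight 7,
  Merge 8,
  MoveRight 8,
  Merge 9,
  MoveRight 9,
  Merge 10,
  MoveRight 10,
  Merge 11,
  Merge 11,
  RewriteN 11 [(11,1,True),(5,0,True),(8,0,True),(11,1,True),(5,0,True),(8,0,True),(11,1,True),(5,0,True),(8,0,True),(5,4,True),(5,4,True),(5,4,True),(61,0,True),(42,1,True),(5,8,True),(11,5,True),(5,4,True),(8,4,True),(5,4,True),(11,0,True),(8,1,True),(5,0,True)],
  DeletePair 5,
  DeletePair 4,
  DeletePair 3,
  DeletePair 2,
  DeletePair 1,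
  DeleteEmpty 1]"

lemma t7_t14_certificate_ok:
  "run_item_steps t7_t14_certificate [TPoint 7, TPoint 14, TPoint 7] = Some [TPoint 14]"
  by code_simp

section \<open>The group \<open>G\<close>\<close>

locale G_presentation = group H for H :: "('a, 'b) monoid_scheme" (structure) +
  fixes x y t :: 'a
  assumes x_closed [simp]: "x \<in> carrier H"
    and y_closed [simp]: "y \<in> carrier H"
    and t_closed [simp]: "t \<in> carrier H"
    and relations: "G_relations H x y t"
begin

abbreviation E :: "gen list \<Rightarrow> 'a" where
  "E \<equiv> word_eval H x y"

sublocale words: list_eval H E
  by (rule list_eval_word_eval) (simp_all add: is_group)

lemma E_Cons [simp]: "E (g # w) = gen_val H x y g \<otimes> E w"
  by (simp add: word_eval_def)

lemma gen_val_closed [simp]: "gen_val H x y g \<in> carrier H"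
  by (cases g) (simp_all add: gen_val_def)

lemma gen_val_simps [simp]: "gen_val H x y GX = x" "gen_val H x y GY = y"
  by (simp_all add: gen_val_def)

lemma relators:
  shows x_pow_7: "x [^] (7::nat) = \<one>"
    and y_pow_2: "y [^] (2::nat) = \<one>"
    and xy_pow_3: "(x \<otimes> y) [^] (3::nat) = \<one>"
    and comm_xy_pow_4: "gcomm H x y [^] (4::nat) = \<one>"
    and t_pow_2: "t [^] (2::nat) = \<one>"
    and comm_tx2_yx: "gcomm H (gconj H t (x [^] (2::nat))) (y \<otimes> inv x) = \<one>"
    and comm_ty: "gcomm H t y = \<one>"
    and y_tx2_pow_5: "(y \<otimes> gconj H t (x [^] (2::nat))) [^] (5::nat) = \<one>"
    and xyx2_tx_pow_5: "(x \<otimes> y \<otimes> x [^] (2::nat) \<otimes> gconj H t x) [^] (5::nat) = \<one>"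
    and xt_pow_8: "(x \<otimes> t) [^] (8::nat) = \<one>"
  using relations unfolding G_relations_def by auto

lemma t_mult_t: "t \<otimes> t = \<one>"
  using t_pow_2 by (simp add: numeral_2_eq_2)

lemma inv_y: "inv y = y"
  using y_pow_2 by (simp add: numeral_2_eq_2 inv_equality)

lemma E_replicate: "E (replicate n g) = gen_val H x y g [^] n"
  using words.ev_concat_replicate[of n "[g]"] by simp

lemma inv_x: "inv x = E (replicate 6 GX)"
proof -
  have "E (replicate 6 GX) \<otimes> x = x [^] (7::nat)"
    by (simp add: E_replicate nat_pow_Suc[symmetric])
  then show ?thesis using x_pow_7 by (simp add: inv_equality)
qed

lemma E_inv_word: "E (inv_word w) = inv (E w)"
proof -
  have "E (gen_inv_word g) = inv (E [g])" for g
    by (cases g) (simp_all add: inv_x inv_y)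
  then show ?thesis unfolding inv_word_def by (rule words.ev_concat_rev_map)
qed

lemma N_relators_hold: "words.rules_hold N_relators"
proof -
  have "E [GX, GY, GX, GY, GX, GY] = E (concat (replicate 3 [GX, GY]))"
    by (simp add: numeral_3_eq_3)
  then have xy: "E [GX, GY, GX, GY, GX, GY] = \<one>"
    using xy_pow_3 by (simp add: words.ev_concat_replicate)
  have "E (replicate 6 GX @ [GY, GX, GY]) = gcomm H x y"
    by (simp add: gcomm_def inv_x[symmetric] inv_y m_assoc)
  then have comm: "E (concat (replicate 4 (replicate 6 GX @ [GY, GX, GY]))) = \<one>"
    using comm_xy_pow_4 by (simp only: words.ev_concat_replicate)
  show ?thesis
    using x_pow_7 y_pow_2 xy comm
    by (simp add: words.rules_hold_def N_relators_def E_replicate numeral_2_eq_2)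
qed

lemma E_eq_if_rewrite: "rewrite_chain N_rules c u = Some v \<Longrightarrow> E u = E v"
  using words.valid_derivations_sound[OF N_relators_hold N_derivations_valid]
  by (auto simp: N_rules_def intro: words.rewrite_chain_sound)

lemma y_centralises_t: "y \<in> centraliser t"
  using commute_if_gcomm_one[OF t_closed y_closed comm_ty] by (simp add: centraliser_def)

lemma stab_gen_centralises_t: "E stab_gen \<in> centraliser t"
proof -
  have x4: "E (replicate 4 GX) = inv x \<otimes> inv (x \<otimes> x)"
  proof -
    have "E (replicate 4 GX) \<otimes> (x \<otimes> (x \<otimes> x)) = x [^] (7::nat)"
      by (simp add: E_replicate m_assoc numeral_eq_Suc nat_pow_Suc2 del: nat_pow_Suc)
    then have "inv (x \<otimes> (x \<otimes> x)) = E (replicate 4 GX)"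
      using x_pow_7 by (simp add: inv_equality)
    then show ?thesis by (simp add: inv_mult_group m_assoc)
  qed
  have "y \<otimes> inv x \<in> centraliser (gconj H t (x \<otimes> x))"
    using commute_if_gcomm_one[OF _ _ comm_tx2_yx]
    by (simp add: centraliser_def numeral_2_eq_2)
  then have "x \<otimes> x \<otimes> (y \<otimes> inv x) \<otimes> inv (x \<otimes> x) \<in> centraliser t"
    by (simp add: centraliser_of_gconj)
  moreover have "E stab_gen = x \<otimes> x \<otimes> (y \<otimes> inv x) \<otimes> inv (x \<otimes> x)"
    using x4 by (simp add: stab_gen_def m_assoc numeral_eq_Suc)
  ultimately show ?thesis by simp
qed

lemma stab_word_centralises_t: "E (stab_word L) \<in> centraliser t"
proof (induction L)
  case (Cons b L)
  then show ?case
    using y_centralises_t stab_gen_centralises_t subgroup.m_closed[OF subgroup_centraliser]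
    by (auto simp: stab_word_def)
qed (simp add: stab_word_def subgroup.one_closed[OF subgroup_centraliser])

lemma schreier_step:
  assumes "j \<in> {1..14}"
  shows "gen_perm g j \<in> {1..14}
    \<and> (\<exists>s \<in> centraliser t. E (coset_rep j @ [g]) = s \<otimes> E (coset_rep (gen_perm g j)))"
proof -
  have "schreier_ok j g"
    using assms schreier_data_ok by (cases g) auto
  then obtain L c where "1 \<le> gen_perm g j \<and> gen_perm g j \<le> 14"
    and chain: "rewrite_chain N_rules c (coset_rep j @ [g])
                  = Some (stab_word L @ coset_rep (gen_perm g j))"
    unfolding schreier_ok_def by (auto split: option.splits)
  moreover have "E (coset_rep j @ [g]) = E (stab_word L) \<otimes> E (coset_rep (gen_perm g j))"
    using E_eq_if_rewrite[OF chain] by simp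
  ultimately show ?thesis
    using stab_word_centralises_t[of L] by auto
qed

lemma word_in_centraliser_coset:
  "word_perm u 7 \<in> {1..14} \<and> (\<exists>s \<in> centraliser t. E u = s \<otimes> E (coset_rep (word_perm u 7)))"
proof (induction u rule: rev_induct)
  case Nil
  have "coset_rep 7 = []" by (simp add: coset_rep_def)
  then show ?case
    using subgroup.one_closed[OF subgroup_centraliser[OF t_closed]]
    by (auto simp: word_perm_def intro!: bexI[of _ \<one>])
next
  case (snoc g u)
  define j where "j = word_perm u 7"
  from snoc obtain s where s: "s \<in> centraliser t" and u: "E u = s \<otimes> E (coset_rep j)"
    and j: "j \<in> {1..14}" by (auto simp: j_def)
  from schreier_step[OF j, of g] obtain s' where "gen_perm g j \<in> {1..14}"
    and s': "s' \<in> centraliser t" and step: "E (coset_rep j @ [g]) = s' \<otimes> E (coset_rep (gen_perm g j))"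
    by blast
  moreover have "E (u @ [g]) = (s \<otimes> s') \<otimes> E (coset_rep (gen_perm g j))"
    using u step s s' by (simp add: centraliser_def m_assoc)
  moreover have "s \<otimes> s' \<in> centraliser t"
    using s s' subgroup.m_closed[OF subgroup_centraliser] by simp
  moreover have "word_perm (u @ [g]) 7 = gen_perm g j"
    by (simp add: word_perm_def j_def)
  ultimately show ?case by auto
qed

definition t_point :: "nat \<Rightarrow> 'a" where
  "t_point i = gconj H t (E (coset_rep i))"

lemma t_point_closed [simp]: "t_point i \<in> carrier H"
  by (simp add: t_point_def)

lemma t_point_involution: "t_point i \<otimes> t_point i = \<one>"
  by (simp add: t_point_def gconj_involution t_mult_t)

lemma inv_t_point: "inv (t_point i) = t_point i"
  using t_point_involution by (simp add: inv_equality)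

lemma gconj_t_word: "gconj H t (E u) = t_point (word_perm u 7)"
proof -
  obtain s where s: "s \<in> centraliser t" and u: "E u = s \<otimes> E (coset_rep (word_perm u 7))"
    using word_in_centraliser_coset by blast
  then have "s \<in> carrier H" by (simp add: centraliser_def)
  with s u show ?thesis
    by (simp add: gconj_mult gconj_centraliser t_point_def)
qed

lemma gconj_t_point:
  assumes "i \<in> {1..14}"
  shows "gconj H (t_point i) (E u) = t_point (word_perm u i)"
proof -
  have "word_perm (coset_rep i) 7 = i"
    using assms coset_rep_points by auto
  then have "word_perm (coset_rep i @ u) 7 = word_perm u i"
    by (simp add: word_perm_def)
  then show ?thesis
    using gconj_t_word[of "coset_rep i @ u"] by (simp add: t_point_def gconj_mult)
qed

lemma t_point_mult_word:
  assumes "k \<in> {1..14}"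
  shows "t_point k \<otimes> E u = E u \<otimes> t_point (word_perm u k)"
proof -
  have "inv (E u) \<otimes> (t_point k \<otimes> E u) = t_point (word_perm u k)"
    using gconj_t_point[OF assms, of u] by (simp add: gconj_def m_assoc)
  then show ?thesis by (simp add: inv_solve_left')
qed

fun ev_item :: "item \<Rightarrow> 'a" where
  "ev_item (NWord u) = E u"
| "ev_item (TPoint i) = t_point i"

definition ev_items :: "item list \<Rightarrow> 'a" where
  "ev_items M = foldr (\<lambda>a acc. ev_item a \<otimes> acc) M \<one>"

lemma ev_item_closed [simp]: "ev_item a \<in> carrier H"
  by (cases a) simp_all

sublocale items: list_eval H ev_items
  unfolding ev_items_def by (rule list_eval_foldr) simp

lemma ev_items_Cons [simp]: "ev_items (a # M) = ev_item a \<otimes> ev_items M"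
  by (simp add: ev_items_def)

lemma t_relators_one: "k < 3 \<Longrightarrow> ev_items (t_relators ! k) = \<one>"
proof -
  assume "k < 3"
  then have "k = 0 \<or> k = 1 \<or> k = 2" by auto
  moreover have "t_point 7 = t" "t_point 1 = gconj H t x" "t_point 2 = gconj H t (x [^] (2::nat))"
    by (simp_all add: t_point_def coset_rep_def gconj_def numeral_2_eq_2)
  ultimately show ?thesis
    using xt_pow_8 y_tx2_pow_5 xyx2_tx_pow_5
    by (auto simp: t_relators_def items.ev_concat_replicate m_assoc numeral_2_eq_2)
qed

lemma relator_conj_one: "k < 3 \<Longrightarrow> ev_items (relator_conj k r fwd g) = \<one>"
proof -
  assume k: "k < 3"
  have "ev_items [inv_item a] = inv (ev_items [a])" for a
    by (cases a) (simp_all add: E_inv_word inv_t_point)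
  then have "ev_items (inv_items M) = inv (ev_items M)" for M
    unfolding inv_items_def by (rule items.ev_concat_rev_map)
  with t_relators_one[OF k] have "ev_items (rotate r (if fwd then t_relators ! k
      else inv_items (t_relators ! k))) = \<one>"
    by (auto intro: items.ev_rotate)
  then show ?thesis by (simp add: relator_conj_def E_inv_word)
qed

lemma ev_items_replace_drop:
  assumes "drop p M = D" "M' = take p M @ D'" "ev_items D = ev_items D'"
  shows "ev_items M = ev_items M'"
  using assms items.ev_replace_drop[of p M D'] by simp

lemma apply_item_step_sound:
  assumes "apply_item_step s M = Some M'"
  shows "ev_items M = ev_items M'"
proof (cases s)
  case (InsertPair p i)
  with assms show ?thesis
    by (auto split: if_splits intro!: ev_items_replace_drop[of p M "drop p M"]
        simp: m_assoc[symmetric] t_point_involution)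
next
  case (DeletePair p)
  with assms show ?thesis
    by (auto split: list.splits item.splits if_splits intro!: ev_items_replace_drop[of p M "drop p M"]
        simp: m_assoc[symmetric] t_point_involution)
next
  case (InsertRelator p k r fwd g)
  with assms show ?thesis
    by (auto split: if_splits intro!: ev_items_replace_drop[of p M "drop p M"] simp: relator_conj_one)
next
  case (MoveRight p)
  with assms show ?thesis
    by (auto split: list.splits item.splits if_splits intro!: ev_items_replace_drop[of p M "drop p M"]
        simp: Let_def m_assoc[symmetric] t_point_mult_word)
next
  case (Merge p)
  with assms show ?thesis
    by (auto split: list.splits item.splits intro!: ev_items_replace_drop[of p M "drop p M"]
        simp: m_assoc)
next
  case (RewriteN p c)
  with assms show ?thesis
    by (auto split: list.splits item.splits intro!: ev_items_replace_drop[of p M "drop p M"]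
        dest: E_eq_if_rewrite)
next
  case (DeleteEmpty p)
  with assms show ?thesis
    by (auto split: list.splits item.splits intro!: ev_items_replace_drop[of p M "drop p M"])
qed

lemma run_item_steps_sound: "run_item_steps ss M = Some M' \<Longrightarrow> ev_items M = ev_items M'"
proof (induction ss arbitrary: M)
  case (Cons s ss)
  then obtain M1 where "apply_item_step s M = Some M1" and "run_item_steps ss M1 = Some M'"
    by (auto split: Option.bind_splits)
  with Cons show ?case by (metis apply_item_step_sound)
qed simp

lemma t7_t14_commute: "t_point 7 \<otimes> t_point 14 = t_point 14 \<otimes> t_point 7"
proof -
  have "t_point 7 \<otimes> (t_point 14 \<otimes> t_point 7) = t_point 14"
    using run_item_steps_sound[OF t7_t14_certificate_ok] by simp
  then have "t_point 7 \<otimes> (t_point 7 \<otimes> (t_point 14 \<otimes> t_point 7)) = t_point 7 \<otimes> t_point 14"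
    by simp
  then show ?thesis by (simp add: m_assoc[symmetric] t_point_involution)
qed

lemma t_point_opposite_commute:
  assumes "i \<in> {1..14}"
  shows "t_point i \<otimes> t_point (idx14 (i + 7)) = t_point (idx14 (i + 7)) \<otimes> t_point i"
proof -
  have "word_perm (coset_rep i) 7 = i" "word_perm (coset_rep i) 14 = idx14 (i + 7)"
    using assms coset_rep_points by auto
  then have "t_point i = gconj H (t_point 7) (E (coset_rep i))"
    and "t_point (idx14 (i + 7)) = gconj H (t_point 14) (E (coset_rep i))"
    by (simp_all add: gconj_t_point)
  then show ?thesis by (simp add: gconj_commute t7_t14_commute)
qed

lemma s_involution:
  assumes "i \<in> {1..14}" "word_perm u 7 = i" "word_perm v 7 = idx14 (i + 7)"
  shows "(gconj H t (E u) \<otimes> gconj H t (E v)) [^] (2::nat) = \<one>"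
  using assms t_point_opposite_commute[of i]
  by (simp add: gconj_t_word commuting_involutions_product t_point_involution)

lemma s_opposite_eq:
  assumes "i \<in> {1..7}" "word_perm u 7 = i" "word_perm v 7 = idx14 (i + 7)"
    and "word_perm u' 7 = idx14 (i + 7)" "word_perm v' 7 = idx14 (i + 14)"
  shows "gconj H t (E u) \<otimes> gconj H t (E v) = gconj H t (E u') \<otimes> gconj H t (E v')"
proof -
  have "1 \<le> i" "i \<le> 7"
    using assms(1) by simp_all
  then have "idx14 (i + 14) = i"
    unfolding idx14_def by presburger
  with assms show ?thesis
    using t_point_opposite_commute[of i] by (simp add: gconj_t_word)
qed

end

theorem lemma3p1:
  fixes H :: "('a, 'b) monoid_scheme" and x y t :: 'a
  assumes "group H"
    and "x \<in> carrier H" and "y \<in> carrier H" and "t \<in> carrier H"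
    and "G_relations H x y t"
  shows "(\<forall>i\<in>{1..14}. \<forall>u v.
            word_perm u 7 = i \<and> word_perm v 7 = idx14 (i + 7) \<longrightarrow>
            (gconj H t (word_eval H x y u) \<otimes>\<^bsub>H\<^esub> gconj H t (word_eval H x y v))
              [^]\<^bsub>H\<^esub> (2::nat) = \<one>\<^bsub>H\<^esub>)
       \<and> (\<forall>i\<in>{1..7}. \<forall>u v u' v'.
            word_perm u 7 = i \<and> word_perm v 7 = idx14 (i + 7) \<and>
            word_perm u' 7 = idx14 (i + 7) \<and> word_perm v' 7 = idx14 (i + 14) \<longrightarrow>
            gconj H t (word_eval H x y u) \<otimes>\<^bsub>H\<^esub> gconj H t (word_eval H x y v)
              = gconj H t (word_eval H x y u') \<otimes>\<^bsub>H\<^esub> gconj H t (word_eval H x y v'))"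
proof -
  interpret G_presentation H x y t
    using assms by (intro G_presentation.intro G_presentation_axioms.intro)
  show ?thesis
    using s_involution s_opposite_eq by auto
qed

end
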